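(* Let $\gamma>0$, let $\Omega\subset\mathbb{R}^N$ be a bounded smooth domain, and let $f:[0,\infty)\to\mathbb{R}$ be locally Lipschitz continuous and non-decreasing, with $f(s)>0$ for $s>0$ and $f(0)\ge 0$. Let $u\in C(\overline{\Omega})\cap C^2(\Omega)$ be a solution to $$-\Delta u=\frac{1}{u^\gamma}+f(u)\ \text{ in }\Omega,\qquad u>0\ \text{ in }\Omega,\qquad u=0\ \text{ on }\partial\Omega ,$$ let $w=u-u_0$, let $\nu\in\mathbb{R}^N$ with $|\nu|=1$, and assume that for some $a(\nu)<\lambda\le\lambda_1(\nu)$ we have $$w\le w_\lambda^\nu\quad\text{in }\Omega_\lambda^\nu .$$ Then $w<w_\lambda^\nu$ in $\Omega_\lambda^\nu$ unless $w\equiv w_\lambda^\nu$ in $\Omega_\lambda^\nu$.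
   Context: $u_0\in C(\overline\Omega)\cap C^2(\Omega)$ denotes the unique solution of $-\Delta u_0=u_0^{-\gamma}$ in $\Omega$, $u_0>0$ in $\Omega$, $u_0=0$ on $\partial\Omega$. It is known that $w=u-u_0\in H^1_0(\Omega)$, i.e. $u=u_0+w$ with $w\in H_0^1(\Omega)$. Notation: $\Omega_\lambda^\nu=\{x\in\Omega: x\cdot\nu<\lambda\}$; $x_\lambda^\nu=R_\lambda^\nu(x)=x+2(\lambda-x\cdot\nu)\nu$ is the reflection through the hyperplane $\{x\cdot\nu=\lambda\}$; $(\Omega_\lambda^\nu)'=R_\lambda^\nu(\Omega_\lambda^\nu)$; $a(\nu)=\inf_{x\in\Omega}x\cdot\nu$; $\lambda_1(\nu)=\sup\{\lambda>a(\nu): (\Omega_t^\nu)'\subset\Omega\text{ for all } a(\nu)<t\le\lambda\}$; $w_\lambda^\nu(x)=w(x_\lambda^\nu)$. *)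

theory Defs
  imports "HOL-Analysis.Analysis"
begin

definition partial_deriv :: "'a::euclidean_space \<Rightarrow> ('a \<Rightarrow> real) \<Rightarrow> 'a \<Rightarrow> real" where
  "partial_deriv b f x = frechet_derivative f (at x) b"

definition laplacian :: "('a::euclidean_space \<Rightarrow> real) \<Rightarrow> 'a \<Rightarrow> real" where
  "laplacian f x = (\<Sum>b\<in>Basis. partial_deriv b (partial_deriv b f) x)"

(* Intended for open S only: the derivatives are two-sided derivatives at points of S. *)
primrec Ck_on :: "nat \<Rightarrow> ('a::euclidean_space \<Rightarrow> real) \<Rightarrow> 'a set \<Rightarrow> bool" where
  "Ck_on 0 f S \<longleftrightarrow> continuous_on S f"
| "Ck_on (Suc k) f S \<longleftrightarrow>
     (\<forall>x\<in>S. f differentiable at x) \<and> (\<forall>b\<in>Basis. Ck_on k (partial_deriv b f) S)"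

(* Near each boundary point p, the set is the part of a ball lying strictly above the graph of a
   C^infinity function g over the hyperplane orthogonal to a unit vector n. The vector
   y - (y \<bullet> n) n is the orthogonal projection of y to that hyperplane; a smooth function on the
   hyperplane is the restriction of a smooth function on the whole space, so g is taken there. *)
definition smooth_boundary :: "'a::euclidean_space set \<Rightarrow> bool" where
  "smooth_boundary \<Omega> \<longleftrightarrow>
     (\<forall>p\<in>frontier \<Omega>. \<exists>r>0. \<exists>n g. norm n = 1 \<and> (\<forall>k. Ck_on k g UNIV) \<and>
        \<Omega> \<inter> ball p r = {y \<in> ball p r. y \<bullet> n > g (y - (y \<bullet> n) *\<^sub>R n)})"

definition bounded_smooth_domain :: "'a::euclidean_space set \<Rightarrow> bool" where
  "bounded_smooth_domain \<Omega> \<longleftrightarrow>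
     open \<Omega> \<and> connected \<Omega> \<and> \<Omega> \<noteq> {} \<and> bounded \<Omega> \<and> smooth_boundary \<Omega>"

(* Positive classical solution of -Laplace v = h(v) in \<Omega>, v = 0 on the boundary. Only the values
   of v on the closure of \<Omega> matter. *)
definition positive_solution :: "'a::euclidean_space set \<Rightarrow> (real \<Rightarrow> real) \<Rightarrow> ('a \<Rightarrow> real) \<Rightarrow> bool" where
  "positive_solution \<Omega> h v \<longleftrightarrow>
     continuous_on (closure \<Omega>) v \<and> Ck_on 2 v \<Omega> \<and>
     (\<forall>x\<in>\<Omega>. - laplacian v x = h (v x)) \<and>
     (\<forall>x\<in>\<Omega>. v x > 0) \<and>
     (\<forall>x\<in>frontier \<Omega>. v x = 0)"

definition cap :: "'a::euclidean_space set \<Rightarrow> 'a \<Rightarrow> real \<Rightarrow> 'a set" where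
  "cap \<Omega> \<nu> t = {x \<in> \<Omega>. x \<bullet> \<nu> < t}"

definition reflection :: "'a::euclidean_space \<Rightarrow> real \<Rightarrow> 'a \<Rightarrow> 'a" where
  "reflection \<nu> t x = x + (2 * (t - x \<bullet> \<nu>)) *\<^sub>R \<nu>"

definition a_inf :: "'a::euclidean_space set \<Rightarrow> 'a \<Rightarrow> real" where
  "a_inf \<Omega> \<nu> = (INF x\<in>\<Omega>. x \<bullet> \<nu>)"

(* The supremum is taken in the extended reals, where it is meaningful for every set of reals;
   for a bounded smooth domain it is a real number. *)
definition lambda1 :: "'a::euclidean_space set \<Rightarrow> 'a \<Rightarrow> ereal" where
  "lambda1 \<Omega> \<nu> = Sup {ereal l | l. l > a_inf \<Omega> \<nu> \<and>
     (\<forall>t. a_inf \<Omega> \<nu> < t \<and> t \<le> l \<longrightarrow> reflection \<nu> t ` cap \<Omega> \<nu> t \<subseteq> \<Omega>)}"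

end

theory Submission
  imports Defs
begin

text \<open>
  Write \<open>R\<close> for the reflection and \<open>D\<close> for the cap. The difference \<open>z = w \<circ> R - w\<close> is nonnegative
  on \<open>D\<close>, and the strong maximum principle applies to it once a linear differential inequality
  \<open>\<Delta>z \<le> c z\<close> with locally bounded \<open>c\<close> is known. Three comparison arguments prepare this; each one
  looks at an interior minimum, where the Laplacian is nonnegative (\<open>interior_minimum\<close>).

  First, \<open>w > 0\<close> in \<open>\<Omega>\<close> (\<open>positive_solution_diff_pos\<close>): at a minimum with \<open>u \<le> u0\<close> one has
  \<open>-\<Delta>w = u powr -\<gamma> - u0 powr -\<gamma> + f u > 0\<close>. Second, \<open>R\<close> maps \<open>D\<close> into \<open>\<Omega>\<close>. At the critical value
  of the parameter a limiting argument only yields the closure of \<open>\<Omega>\<close>, but a point sent to the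
  boundary would satisfy \<open>0 < w x \<le> w (R x) = 0\<close>. Third, \<open>u0 \<le> u0 \<circ> R\<close> on \<open>D\<close>
  (\<open>solution_le_reflection\<close>), because the nonlinearity \<open>s powr -\<gamma>\<close> is decreasing.

  Since \<open>f\<close> is non-decreasing and \<open>a powr -\<gamma> - (a + t) powr -\<gamma>\<close> is decreasing in \<open>a\<close>, the third fact
  gives \<open>\<Delta>z \<le> u powr -\<gamma> - (u + z) powr -\<gamma> \<le> \<gamma> u powr (-\<gamma>-1) z\<close>
  (\<open>reaction_difference_bound\<close>), so the zero set \<open>Z\<close> of \<open>z\<close> is open and closed in \<open>D\<close>
  (\<open>open_zero_set\<close>).

  The cap need not be connected, so this alone does not yield \<open>Z = {}\<close> or \<open>Z = D\<close>. If \<open>Z\<close> is nonempty,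
  the positivity of \<open>w\<close> prevents points of \<open>closure Z\<close> on the boundary of \<open>\<Omega>\<close> from being reflected
  into \<open>\<Omega>\<close>. It follows that \<open>\<Omega> \<inter> closure (Z \<union> R ` Z)\<close> is open and closed in \<open>\<Omega>\<close>, hence equal to
  \<open>\<Omega>\<close>, and intersecting with the half space of the cap gives \<open>Z = D\<close>
  (\<open>reflection_symmetric_domain\<close>).
\<close>

section \<open>Second derivatives along lines\<close>

text \<open>
  The function \<open>t \<mapsto> f (x + t v)\<close> is differentiable near \<open>0\<close> and its derivative \<open>g\<close> has derivative \<open>c\<close>
  at \<open>0\<close>. This one-dimensional notion is enough for the second derivative test at a minimum and is
  transported by reflections without computing iterated partial derivatives of a composition.
\<close>
definition has_second_deriv_along :: "('a::euclidean_space \<Rightarrow> real) \<Rightarrow> 'a \<Rightarrow> 'a \<Rightarrow> real \<Rightarrow> bool" where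
  "has_second_deriv_along f x v c \<longleftrightarrow>
     (\<exists>g. (\<forall>\<^sub>F t in nhds 0. ((\<lambda>s. f (x + s *\<^sub>R v)) has_real_derivative g t) (at t)) \<and>
          (g has_real_derivative c) (at 0))"

lemma has_second_deriv_along_diff:
  assumes "has_second_deriv_along f x v c" "has_second_deriv_along g x v d"
  shows "has_second_deriv_along (\<lambda>y. f y - g y) x v (c - d)"
proof -
  obtain f' g' where
    f: "\<forall>\<^sub>F t in nhds 0. ((\<lambda>s. f (x + s *\<^sub>R v)) has_real_derivative f' t) (at t)"
       "(f' has_real_derivative c) (at 0)" and
    g: "\<forall>\<^sub>F t in nhds 0. ((\<lambda>s. g (x + s *\<^sub>R v)) has_real_derivative g' t) (at t)"
       "(g' has_real_derivative d) (at 0)"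
    using assms unfolding has_second_deriv_along_def by auto
  have "\<forall>\<^sub>F t in nhds 0.
      ((\<lambda>s. f (x + s *\<^sub>R v) - g (x + s *\<^sub>R v)) has_real_derivative f' t - g' t) (at t)"
    using f(1) g(1) by eventually_elim (rule DERIV_diff)
  moreover have "((\<lambda>t. f' t - g' t) has_real_derivative c - d) (at 0)"
    using f(2) g(2) by (rule DERIV_diff)
  ultimately show ?thesis
    unfolding has_second_deriv_along_def by (intro exI[of _ "\<lambda>t. f' t - g' t"]) simp
qed

lemma has_second_deriv_along_cmult:
  assumes "has_second_deriv_along f x v c"
  shows "has_second_deriv_along (\<lambda>y. k * f y) x v (k * c)"
proof -
  obtain f' where
    f: "\<forall>\<^sub>F t in nhds 0. ((\<lambda>s. f (x + s *\<^sub>R v)) has_real_derivative f' t) (at t)"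
       "(f' has_real_derivative c) (at 0)"
    using assms unfolding has_second_deriv_along_def by auto
  have "\<forall>\<^sub>F t in nhds 0. ((\<lambda>s. k * f (x + s *\<^sub>R v)) has_real_derivative k * f' t) (at t)"
    using f(1) by eventually_elim (rule DERIV_cmult)
  moreover have "((\<lambda>t. k * f' t) has_real_derivative k * c) (at 0)"
    using f(2) by (rule DERIV_cmult)
  ultimately show ?thesis
    unfolding has_second_deriv_along_def by (intro exI[of _ "\<lambda>t. k * f' t"]) simp
qed

lemma second_deriv_along_nonneg_at_minimum:
  assumes f: "has_second_deriv_along f x v c"
    and min: "\<forall>\<^sub>F y in nhds x. f x \<le> f y"
  shows "0 \<le> c"
proof (rule ccontr)
  assume "\<not> 0 \<le> c"
  then have "c < 0" by simp
  define \<phi> where "\<phi> t = f (x + t *\<^sub>R v)" for t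
  obtain g where g: "\<forall>\<^sub>F t in nhds 0. (\<phi> has_real_derivative g t) (at t)"
    and g0: "(g has_real_derivative c) (at 0)"
    using f unfolding has_second_deriv_along_def \<phi>_def by auto
  have "((\<lambda>t. x + t *\<^sub>R v) \<longlongrightarrow> x + 0 *\<^sub>R v) (nhds 0)"
    by (intro tendsto_intros filterlim_ident)
  then have "\<forall>\<^sub>F t in nhds 0. f x \<le> f (x + t *\<^sub>R v)"
    using eventually_compose_filterlim[OF min, of "\<lambda>t. x + t *\<^sub>R v"] by simp
  then have "\<forall>\<^sub>F t in nhds 0. \<phi> 0 \<le> \<phi> t"
    unfolding \<phi>_def by simp
  with g have "\<forall>\<^sub>F t in nhds 0. (\<phi> has_real_derivative g t) (at t) \<and> \<phi> 0 \<le> \<phi> t"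
    by eventually_elim blast
  then obtain d where d: "d > 0"
    and dd: "\<And>t. \<bar>t\<bar> < d \<Longrightarrow> (\<phi> has_real_derivative g t) (at t) \<and> \<phi> 0 \<le> \<phi> t"
    unfolding eventually_nhds_metric dist_real_def by auto
  have "g 0 = 0"
    by (rule DERIV_local_min[of \<phi> "g 0" 0 d]) (use d dd in auto)
  obtain e where e: "e > 0" "\<And>h. h > 0 \<Longrightarrow> h < e \<Longrightarrow> g h < g 0"
    using DERIV_neg_dec_right[OF g0 \<open>c < 0\<close>] by auto
  define t where "t = min d e / 2"
  have t: "0 < t" "t < d" "t < e"
    using d e(1) by (auto simp: t_def)
  have "\<exists>\<xi>. \<xi> > 0 \<and> \<xi> < t \<and> \<phi> t - \<phi> 0 = (t - 0) * g \<xi>"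
    by (rule MVT2[OF t(1)]) (use t dd in auto)
  then obtain \<xi> where \<xi>: "\<xi> > 0" "\<xi> < t" "\<phi> t - \<phi> 0 = t * g \<xi>" by auto
  have "g \<xi> < 0"
    using e(2)[of \<xi>] \<xi> t \<open>g 0 = 0\<close> by auto
  then have "\<phi> t < \<phi> 0"
    using \<xi>(3) t(1) mult_pos_neg[of t "g \<xi>"] by linarith
  then show False
    using dd[of t] t by auto
qed

lemma has_real_derivative_along_line:
  fixes f :: "'a::euclidean_space \<Rightarrow> real"
  assumes "f differentiable at (x + t *\<^sub>R v)"
  shows "((\<lambda>s. f (x + s *\<^sub>R v)) has_real_derivative
           (\<Sum>b\<in>Basis. (v \<bullet> b) * partial_deriv b f (x + t *\<^sub>R v))) (at t)"
proof -
  let ?y = "x + t *\<^sub>R v"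
  let ?F = "frechet_derivative f (at ?y)"
  have F: "(f has_derivative ?F) (at ?y)"
    using assms by (simp add: frechet_derivative_works)
  then have lin: "linear ?F"
    by (rule has_derivative_linear)
  have "?F v = ?F (\<Sum>b\<in>Basis. (v \<bullet> b) *\<^sub>R b)"
    by (simp add: euclidean_representation)
  also have "\<dots> = (\<Sum>b\<in>Basis. (v \<bullet> b) * partial_deriv b f ?y)"
    by (simp add: linear_sum[OF lin] linear_cmul[OF lin] partial_deriv_def)
  finally have Fv: "?F v = (\<Sum>b\<in>Basis. (v \<bullet> b) * partial_deriv b f ?y)" .
  have "((\<lambda>s. x + s *\<^sub>R v) has_derivative (\<lambda>s. s *\<^sub>R v)) (at t)"
    by (auto intro!: derivative_eq_intros)
  from has_derivative_compose[OF this F]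
  have "((\<lambda>s. f (x + s *\<^sub>R v)) has_derivative (\<lambda>s. ?F (s *\<^sub>R v))) (at t)"
    by simp
  moreover have "(\<lambda>s. ?F (s *\<^sub>R v)) = (*) (?F v)"
    by (auto simp: linear_cmul[OF lin])
  ultimately show ?thesis
    unfolding has_field_derivative_def Fv by simp
qed

lemma Ck_on_2_has_second_deriv_along:
  fixes f :: "'a::euclidean_space \<Rightarrow> real"
  assumes S: "open S" and f: "Ck_on 2 f S" and x: "x \<in> S"
  shows "has_second_deriv_along f x v
    (\<Sum>j\<in>Basis. \<Sum>i\<in>Basis. (v \<bullet> j) * (v \<bullet> i) * partial_deriv i (partial_deriv j f) x)"
proof -
  have d1: "\<And>y. y \<in> S \<Longrightarrow> f differentiable at y"
    and d2: "\<And>y b. y \<in> S \<Longrightarrow> b \<in> Basis \<Longrightarrow> partial_deriv b f differentiable at y"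
    using f by (auto simp: numeral_2_eq_2)
  have "((\<lambda>t. x + t *\<^sub>R v) \<longlongrightarrow> x + 0 *\<^sub>R v) (nhds 0)"
    by (intro tendsto_intros filterlim_ident)
  then have "\<forall>\<^sub>F t in nhds 0. x + t *\<^sub>R v \<in> S"
    using S x by (auto dest: topological_tendstoD)
  then have 1: "\<forall>\<^sub>F t in nhds 0. ((\<lambda>s. f (x + s *\<^sub>R v)) has_real_derivative
      (\<Sum>j\<in>Basis. (v \<bullet> j) * partial_deriv j f (x + t *\<^sub>R v))) (at t)"
    by eventually_elim (rule has_real_derivative_along_line[OF d1])
  have "((\<lambda>t. \<Sum>j\<in>Basis. (v \<bullet> j) * partial_deriv j f (x + t *\<^sub>R v)) has_real_derivative
      (\<Sum>j\<in>Basis. (v \<bullet> j) * (\<Sum>i\<in>Basis. (v \<bullet> i) * partial_deriv i (partial_deriv j f) (x + 0 *\<^sub>R v))))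
      (at 0)"
    by (intro DERIV_sum DERIV_cmult has_real_derivative_along_line d2) (use x in auto)
  then have 2: "((\<lambda>t. \<Sum>j\<in>Basis. (v \<bullet> j) * partial_deriv j f (x + t *\<^sub>R v)) has_real_derivative
      (\<Sum>j\<in>Basis. \<Sum>i\<in>Basis. (v \<bullet> j) * (v \<bullet> i) * partial_deriv i (partial_deriv j f) x)) (at 0)"
    by (simp add: sum_distrib_left mult.assoc)
  show ?thesis
    unfolding has_second_deriv_along_def
    by (rule exI[of _ "\<lambda>t. \<Sum>j\<in>Basis. (v \<bullet> j) * partial_deriv j f (x + t *\<^sub>R v)"])
       (use 1 2 in blast)
qed

section \<open>The Laplacian\<close>

text \<open>
  The pure second derivatives along the standard basis exist at \<open>x\<close> and sum to \<open>l\<close>. For functions of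
  class \<open>C\<^sup>2\<close> the value is that of \<^const>\<open>laplacian\<close>.
\<close>
definition has_laplacian :: "('a::euclidean_space \<Rightarrow> real) \<Rightarrow> 'a \<Rightarrow> real \<Rightarrow> bool" where
  "has_laplacian f x l \<longleftrightarrow>
     (\<exists>c. (\<forall>b\<in>Basis. has_second_deriv_along f x b (c b)) \<and> l = (\<Sum>b\<in>Basis. c b))"

lemma has_laplacian_diff:
  assumes "has_laplacian f x l" "has_laplacian g x m"
  shows "has_laplacian (\<lambda>y. f y - g y) x (l - m)"
proof -
  obtain c d where "\<forall>b\<in>Basis. has_second_deriv_along f x b (c b)" "l = (\<Sum>b\<in>Basis. c b)"
    "\<forall>b\<in>Basis. has_second_deriv_along g x b (d b)" "m = (\<Sum>b\<in>Basis. d b)"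
    using assms unfolding has_laplacian_def by auto
  then show ?thesis
    unfolding has_laplacian_def
    by (intro exI[of _ "\<lambda>b. c b - d b"]) (auto intro: has_second_deriv_along_diff simp: sum_subtractf)
qed

lemma has_laplacian_cmult:
  assumes "has_laplacian f x l"
  shows "has_laplacian (\<lambda>y. k * f y) x (k * l)"
proof -
  obtain c where "\<forall>b\<in>Basis. has_second_deriv_along f x b (c b)" "l = (\<Sum>b\<in>Basis. c b)"
    using assms unfolding has_laplacian_def by auto
  then show ?thesis
    unfolding has_laplacian_def
    by (intro exI[of _ "\<lambda>b. k * c b"]) (auto intro: has_second_deriv_along_cmult simp: sum_distrib_left)
qed

lemma laplacian_nonneg_at_minimum:
  assumes "has_laplacian f x l" "\<forall>\<^sub>F y in nhds x. f x \<le> f y"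
  shows "0 \<le> l"
proof -
  obtain c where c: "\<forall>b\<in>Basis. has_second_deriv_along f x b (c b)" and l: "l = (\<Sum>b\<in>Basis. c b)"
    using assms(1) unfolding has_laplacian_def by auto
  have "0 \<le> c b" if "b \<in> Basis" for b
    by (rule second_deriv_along_nonneg_at_minimum[OF bspec[OF c that] assms(2)])
  then show ?thesis
    unfolding l by (rule sum_nonneg)
qed

lemma sum_Basis_delta:
  fixes a :: "'a::euclidean_space \<Rightarrow> 'a \<Rightarrow> real"
  shows "(\<Sum>j\<in>Basis. \<Sum>i\<in>Basis. (j \<bullet> i) * a j i) = (\<Sum>j\<in>Basis. a j j)"
proof (rule sum.cong[OF refl])
  fix j :: 'a assume j: "j \<in> Basis"
  have "(\<Sum>i\<in>Basis. (j \<bullet> i) * a j i) = (\<Sum>i\<in>Basis. if i = j then a j i else 0)"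
    by (rule sum.cong) (auto simp: inner_Basis j)
  then show "(\<Sum>i\<in>Basis. (j \<bullet> i) * a j i) = a j j"
    using j by simp
qed

lemma Ck_on_2_has_laplacian:
  assumes "open S" "Ck_on 2 f S" "x \<in> S"
  shows "has_laplacian f x (laplacian f x)"
proof -
  have "has_second_deriv_along f x b (partial_deriv b (partial_deriv b f) x)" if b: "b \<in> Basis" for b
  proof -
    have "(\<Sum>j\<in>Basis. \<Sum>i\<in>Basis. (b \<bullet> j) * (b \<bullet> i) * partial_deriv i (partial_deriv j f) x)
      = (\<Sum>j\<in>Basis. \<Sum>i\<in>Basis. if i = b then (if j = b then partial_deriv i (partial_deriv j f) x else 0) else 0)"
      by (intro sum.cong refl) (auto simp: inner_Basis b)
    also have "\<dots> = partial_deriv b (partial_deriv b f) x"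
      using b by simp
    finally show ?thesis
      using Ck_on_2_has_second_deriv_along[OF assms, of b] by simp
  qed
  then show ?thesis
    unfolding has_laplacian_def laplacian_def
    by (intro exI[of _ "\<lambda>b. partial_deriv b (partial_deriv b f) x"]) simp
qed

section \<open>Reflections\<close>

lemma inner_reflection:
  assumes "norm \<nu> = 1"
  shows "reflection \<nu> t x \<bullet> \<nu> = 2 * t - x \<bullet> \<nu>"
  using assms by (simp add: reflection_def inner_add_left dot_square_norm)

lemma reflection_reflection:
  assumes "norm \<nu> = 1"
  shows "reflection \<nu> t (reflection \<nu> t x) = x"
proof -
  have "reflection \<nu> t (reflection \<nu> t x)
      = reflection \<nu> t x + (2 * (t - reflection \<nu> t x \<bullet> \<nu>)) *\<^sub>R \<nu>"
    by (simp add: reflection_def)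
  also have "\<dots> = reflection \<nu> t x - (2 * (t - x \<bullet> \<nu>)) *\<^sub>R \<nu>"
    unfolding inner_reflection[OF assms] by (simp add: algebra_simps)
  finally show ?thesis
    by (simp add: reflection_def)
qed

lemma reflection_fixed: "x \<bullet> \<nu> = t \<Longrightarrow> reflection \<nu> t x = x"
  by (simp add: reflection_def)

lemma continuous_on_reflection: "continuous_on S (reflection \<nu> t)"
  unfolding reflection_def by (intro continuous_intros)

lemma dist_reflection:
  assumes "norm \<nu> = 1"
  shows "dist (reflection \<nu> t x) (reflection \<nu> t y) = dist x y"
proof -
  define d where "d = x - y"
  have nn: "\<nu> \<bullet> \<nu> = 1" using assms by (simp add: dot_square_norm)
  have "reflection \<nu> t x - reflection \<nu> t y = d - (2 * (d \<bullet> \<nu>)) *\<^sub>R \<nu>"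
    by (simp add: d_def reflection_def algebra_simps inner_diff_left)
  moreover have "norm (d - (2 * (d \<bullet> \<nu>)) *\<^sub>R \<nu>) = norm d"
    by (simp add: norm_eq nn inner_diff_left inner_diff_right inner_commute algebra_simps)
  ultimately show ?thesis
    by (simp add: dist_norm d_def)
qed

text \<open>
  The linear part of the reflection is orthogonal and self-adjoint, so the trace of the Hessian
  matrix is unchanged; symmetry of that matrix is not needed.
\<close>
lemma has_laplacian_compose_reflection:
  fixes f :: "'a::euclidean_space \<Rightarrow> real"
  assumes S: "open S" and f: "Ck_on 2 f S" and x: "reflection \<nu> t x \<in> S" and \<nu>: "norm \<nu> = 1"
  shows "has_laplacian (\<lambda>y. f (reflection \<nu> t y)) x (laplacian f (reflection \<nu> t x))"
proof -
  define y where "y = reflection \<nu> t x"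
  define R :: "'a \<Rightarrow> 'a" where "R v = v - (2 * (v \<bullet> \<nu>)) *\<^sub>R \<nu>" for v
  define a where "a j i = partial_deriv i (partial_deriv j f) y" for i j
  define c where "c v = (\<Sum>j\<in>Basis. \<Sum>i\<in>Basis. (R v \<bullet> j) * (R v \<bullet> i) * a j i)" for v
  have nn: "\<nu> \<bullet> \<nu> = 1" using \<nu> by (simp add: dot_square_norm)
  have line: "reflection \<nu> t (x + s *\<^sub>R v) = y + s *\<^sub>R R v" for s v
    by (simp add: y_def R_def reflection_def algebra_simps)
  have adj: "R v \<bullet> j = R j \<bullet> v" for v j
    by (simp add: R_def inner_diff_left inner_commute[of j v] inner_commute[of \<nu>])
  have iso: "R v \<bullet> R j = v \<bullet> j" for v j
    by (simp add: R_def inner_diff_left inner_diff_right nn inner_commute algebra_simps)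
  have "has_second_deriv_along (\<lambda>y. f (reflection \<nu> t y)) x v (c v)" for v
    using Ck_on_2_has_second_deriv_along[OF S f x, of "R v"]
    unfolding has_second_deriv_along_def line c_def a_def y_def[symmetric] .
  moreover have "(\<Sum>b\<in>Basis. c b) = laplacian f y"
  proof -
    have "(\<Sum>b\<in>Basis. c b)
        = (\<Sum>j\<in>Basis. \<Sum>b\<in>Basis. \<Sum>i\<in>Basis. (R b \<bullet> j) * (R b \<bullet> i) * a j i)"
      unfolding c_def by (rule sum.swap)
    also have "\<dots> = (\<Sum>j\<in>Basis. \<Sum>i\<in>Basis. \<Sum>b\<in>Basis. (R b \<bullet> j) * (R b \<bullet> i) * a j i)"
      by (intro sum.cong refl sum.swap)
    also have "\<dots> = (\<Sum>j\<in>Basis. \<Sum>i\<in>Basis. (\<Sum>b\<in>Basis. (R j \<bullet> b) * (R i \<bullet> b)) * a j i)"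
      by (simp only: adj sum_distrib_right)
    also have "\<dots> = (\<Sum>j\<in>Basis. \<Sum>i\<in>Basis. (j \<bullet> i) * a j i)"
      by (simp only: euclidean_inner[symmetric] iso)
    also have "\<dots> = laplacian f y"
      unfolding sum_Basis_delta by (simp add: laplacian_def a_def)
    finally show ?thesis .
  qed
  ultimately show ?thesis
    unfolding has_laplacian_def y_def by metis
qed

section \<open>Maximum principles\<close>

text \<open>
  If some interior value is at most all boundary values, then there is an interior point with an at
  most equal value and a nonnegative Laplacian: a minimum over the closure, or, when that
  was found on the boundary, the given point, which is then a minimum as well.
\<close>
lemma interior_minimum:
  fixes v :: "'a::euclidean_space \<Rightarrow> real"
  assumes D: "open D" "bounded D" and v: "continuous_on (closure D) v"
    and L: "\<And>x. x \<in> D \<Longrightarrow> has_laplacian v x (L x)"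
    and x0: "x0 \<in> D" and bd: "\<And>y. y \<in> frontier D \<Longrightarrow> v x0 \<le> v y"
  obtains p where "p \<in> D" "v p \<le> v x0" "0 \<le> L p"
proof -
  have "compact (closure D)" using D by (simp add: compact_closure)
  moreover have "closure D \<noteq> {}" using x0 by auto
  ultimately obtain q where q: "q \<in> closure D" "\<And>y. y \<in> closure D \<Longrightarrow> v q \<le> v y"
    using continuous_attains_inf[OF _ _ v] by auto
  have x0c: "x0 \<in> closure D" using x0 closure_subset by blast
  define p where "p = (if q \<in> D then q else x0)"
  have pD: "p \<in> D" using x0 by (simp add: p_def)
  have "v x0 \<le> v q" if "q \<notin> D"
    using that q(1) D(1) by (intro bd) (simp add: frontier_def interior_open)
  then have pmin: "v p \<le> v y" if "y \<in> closure D" for y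
    using q(2)[OF that] by (auto simp: p_def)
  have "\<forall>\<^sub>F y in nhds p. y \<in> D"
    using D(1) pD by (rule eventually_nhds_in_open)
  then have "\<forall>\<^sub>F y in nhds p. v p \<le> v y"
    by eventually_elim (use pmin closure_subset in blast)
  then have "0 \<le> L p"
    using L[OF pD] laplacian_nonneg_at_minimum by blast
  with pD pmin[OF x0c] show thesis by (rule that)
qed

lemma has_laplacian_barrier:
  fixes x y :: "'a::euclidean_space" and \<alpha> k :: real
  shows "has_laplacian (\<lambda>x. exp (- \<alpha> * (norm (x - y))\<^sup>2) - k) x
    ((4 * \<alpha>\<^sup>2 * (norm (x - y))\<^sup>2 - 2 * \<alpha> * DIM('a)) * exp (- \<alpha> * (norm (x - y))\<^sup>2))"
proof -
  define E where "E = exp (- \<alpha> * (norm (x - y))\<^sup>2)"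
  define c where "c b = (4 * \<alpha>\<^sup>2 * ((x - y) \<bullet> b)\<^sup>2 - 2 * \<alpha>) * E" for b
  have "has_second_deriv_along (\<lambda>x. exp (- \<alpha> * (norm (x - y))\<^sup>2) - k) x b (c b)"
    if b: "b \<in> Basis" for b
  proof -
    define m q where "m = (x - y) \<bullet> b" and "q = (norm (x - y))\<^sup>2"
    have norm_line: "(norm (x + s *\<^sub>R b - y))\<^sup>2 = q + 2 * m * s + s\<^sup>2" for s
    proof -
      have "x + s *\<^sub>R b - y = (x - y) + s *\<^sub>R b" by simp
      then have "(norm (x + s *\<^sub>R b - y))\<^sup>2 = ((x - y) + s *\<^sub>R b) \<bullet> ((x - y) + s *\<^sub>R b)"
        by (simp only: power2_norm_eq_inner)
      also have "\<dots> = (x - y) \<bullet> (x - y) + 2 * s * ((x - y) \<bullet> b) + s * s * (b \<bullet> b)"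
        by (simp only: inner_add_left inner_add_right inner_scaleR_left inner_scaleR_right
            inner_commute[of b "x - y"]) (simp add: algebra_simps)
      finally show ?thesis
        using b by (simp add: m_def q_def power2_norm_eq_inner inner_same_Basis)
          (simp add: power2_eq_square algebra_simps)
    qed
    let ?g = "\<lambda>t. - \<alpha> * (2 * m + 2 * t) * exp (- \<alpha> * (q + 2 * m * t + t\<^sup>2))"
    have 1: "((\<lambda>s. exp (- \<alpha> * (q + 2 * m * s + s\<^sup>2)) - k) has_real_derivative ?g t) (at t)" for t
      by (auto intro!: derivative_eq_intros simp: algebra_simps)
    have "(?g has_real_derivative (4 * \<alpha>\<^sup>2 * m\<^sup>2 - 2 * \<alpha>) * exp (- \<alpha> * q)) (at 0)"
      by (auto intro!: derivative_eq_intros simp: algebra_simps power2_eq_square)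
    with 1 show ?thesis
      unfolding has_second_deriv_along_def norm_line c_def E_def m_def[symmetric] q_def[symmetric]
      by (intro exI[of _ ?g]) simp
  qed
  moreover have "(\<Sum>b\<in>Basis. c b) = (4 * \<alpha>\<^sup>2 * (norm (x - y))\<^sup>2 - 2 * \<alpha> * DIM('a)) * E"
  proof -
    have "(norm (x - y))\<^sup>2 = (\<Sum>b\<in>Basis. ((x - y) \<bullet> b)\<^sup>2)"
      unfolding power2_norm_eq_inner euclidean_inner[of "x - y" "x - y"] by (simp only: power2_eq_square)
    then show ?thesis
      by (simp add: c_def sum_distrib_right[symmetric] sum_subtractf sum_distrib_left[symmetric])
  qed
  ultimately show ?thesis
    unfolding has_laplacian_def E_def by metis
qed

text \<open>
  The Hopf barrier argument. A nonnegative supersolution \<open>z\<close> that is positive near \<open>x1\<close> in a closed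
  ball \<open>cball y \<rho>\<close> with \<open>x1\<close> on its boundary, except possibly at \<open>x1\<close>, is positive at \<open>x1\<close> as well.
  Otherwise, with \<open>h x = exp (-\<alpha> |x - y|\<^sup>2) - exp (-\<alpha> \<rho>\<^sup>2)\<close> and a suitable \<open>m > 0\<close>, the function
  \<open>z - m h\<close> vanishes at \<open>x1\<close> and is nonnegative on the sphere around \<open>x1\<close>, so it has an interior
  point as in \<open>interior_minimum\<close>; but there its Laplacian is negative when \<open>\<alpha>\<close> is large. Working in
  a ball around \<open>x1\<close>, rather than in an annulus around \<open>y\<close>, makes normal derivatives unnecessary.
\<close>
lemma no_isolated_touching_point:
  fixes z :: "'a::euclidean_space \<Rightarrow> real"
  assumes z: "continuous_on (cball x1 r) z" "\<And>x. x \<in> cball x1 r \<Longrightarrow> 0 \<le> z x"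
    and L: "\<And>x. x \<in> ball x1 r \<Longrightarrow> has_laplacian z x (L x)"
    and le: "\<And>x. x \<in> ball x1 r \<Longrightarrow> L x \<le> K * z x"
    and K: "0 \<le> K" and r: "0 < r" "r \<le> \<rho> / 2"
    and x1: "dist y x1 = \<rho>"
    and pos: "\<And>x. x \<in> cball x1 r \<Longrightarrow> x \<in> cball y \<rho> \<Longrightarrow> x \<noteq> x1 \<Longrightarrow> 0 < z x"
  shows "0 < z x1"
proof (rule ccontr)
  assume "\<not> 0 < z x1"
  then have zx1: "z x1 = 0" using z(2)[of x1] r by auto
  have \<rho>: "0 < \<rho>" using r by auto
  define N where "N = real (DIM('a))"
  \<comment> \<open>This makes \<open>\<alpha> * (\<alpha> * \<rho>\<^sup>2 - 2 * N) > K\<close>, hence \<open>\<Delta>h > K * exp (-\<alpha> |x - y|\<^sup>2)\<close> where \<open>|x - y| \<ge> \<rho> / 2\<close>.\<close>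
  define \<alpha> where "\<alpha> = max 1 ((2 * N + K + 1) / \<rho>\<^sup>2)"
  have \<alpha>1: "1 \<le> \<alpha>" by (simp add: \<alpha>_def)
  have "(2 * N + K + 1) / \<rho>\<^sup>2 \<le> \<alpha>" by (simp add: \<alpha>_def)
  then have \<alpha>2: "2 * N + K + 1 \<le> \<alpha> * \<rho>\<^sup>2"
    using \<rho> by (simp add: pos_divide_le_eq)
  define E where "E x = exp (- \<alpha> * (norm (x - y))\<^sup>2)" for x
  define h where "h x = E x - exp (- \<alpha> * \<rho>\<^sup>2)" for x
  have hlap: "has_laplacian h x ((4 * \<alpha>\<^sup>2 * (norm (x - y))\<^sup>2 - 2 * \<alpha> * N) * E x)" for x
    using has_laplacian_barrier[of \<alpha> y "exp (- \<alpha> * \<rho>\<^sup>2)" x] unfolding h_def E_def N_def .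
  have hcont: "continuous_on A h" for A
    unfolding h_def E_def by (intro continuous_intros)
  have E1: "E x \<le> 1" for x using \<alpha>1 by (simp add: E_def)
  have E0: "0 < E x" for x by (simp add: E_def)
  have h1: "h x \<le> 1" and hE: "h x \<le> E x" for x
    using E1[of x] exp_gt_zero[of "- \<alpha> * \<rho>\<^sup>2"] unfolding h_def by linarith+
  have hout: "h x \<le> 0" if "x \<notin> cball y \<rho>" for x
  proof -
    have "\<rho> \<le> norm (x - y)" using that by (simp add: dist_norm norm_minus_commute)
    then have "\<rho>\<^sup>2 \<le> (norm (x - y))\<^sup>2" using \<rho> by (intro power_mono) auto
    then show ?thesis using \<alpha>1 by (simp add: h_def E_def)
  qed
  have hx1: "h x1 = 0" using x1 by (simp add: h_def E_def dist_norm norm_minus_commute)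
  \<comment> \<open>A positive lower bound of \<open>z\<close> on the part of the sphere where the barrier may be positive.\<close>
  obtain m where m: "0 < m" "\<And>x. x \<in> sphere x1 r \<inter> cball y \<rho> \<Longrightarrow> m \<le> z x"
  proof (cases "sphere x1 r \<inter> cball y \<rho> = {}")
    case True
    then show thesis using that[of 1] by auto
  next
    case False
    have "compact (sphere x1 r \<inter> cball y \<rho>)" by (simp add: compact_Int_closed)
    moreover have "continuous_on (sphere x1 r \<inter> cball y \<rho>) z"
      by (rule continuous_on_subset[OF z(1)]) auto
    ultimately obtain q where q: "q \<in> sphere x1 r \<inter> cball y \<rho>"
      "\<And>x. x \<in> sphere x1 r \<inter> cball y \<rho> \<Longrightarrow> z q \<le> z x"
      using continuous_attains_inf[OF _ False] by blast
    have "0 < z q" using q(1) r by (intro pos) auto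
    with q(2) show thesis by (rule that[rotated 1])
  qed
  define v where "v x = z x - m * h x" for x
  have vlap: "has_laplacian v x (L x - m * ((4 * \<alpha>\<^sup>2 * (norm (x - y))\<^sup>2 - 2 * \<alpha> * N) * E x))"
    if "x \<in> ball x1 r" for x
    unfolding v_def by (intro has_laplacian_diff has_laplacian_cmult hlap L that)
  have vc: "continuous_on (closure (ball x1 r)) v"
    unfolding v_def using r by (auto intro!: continuous_intros z(1) hcont)
  have vf: "v x1 \<le> v x" if "x \<in> frontier (ball x1 r)" for x
  proof -
    have xs: "x \<in> sphere x1 r" using that r by (simp add: frontier_ball)
    have "m * h x \<le> z x"
    proof (cases "x \<in> cball y \<rho>")
      case True
      have "m * h x \<le> m * 1" using m(1) h1 by (intro mult_left_mono) auto
      also have "\<dots> \<le> z x" using m(2) True xs by auto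
      finally show ?thesis .
    next
      case False
      then have "m * h x \<le> 0" using hout m(1) by (intro mult_nonneg_nonpos) auto
      also have "\<dots> \<le> z x" using xs by (intro z(2)) auto
      finally show ?thesis .
    qed
    then show ?thesis by (simp add: v_def zx1 hx1)
  qed
  obtain p where p: "p \<in> ball x1 r" "v p \<le> v x1"
    "0 \<le> L p - m * ((4 * \<alpha>\<^sup>2 * (norm (p - y))\<^sup>2 - 2 * \<alpha> * N) * E p)"
    by (rule interior_minimum[OF open_ball bounded_ball vc vlap _ vf]) (use r in auto)
  have "z p \<le> m * h p" using p(2) by (simp add: v_def zx1 hx1)
  also have "\<dots> \<le> m * E p" using m(1) hE by (intro mult_left_mono) auto
  finally have "K * z p \<le> K * (m * E p)" using K by (intro mult_left_mono)
  with le[OF p(1)] have Lp: "L p \<le> K * (m * E p)" by simp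
  have "\<rho> \<le> dist y p + dist p x1" using x1 dist_triangle by metis
  then have "\<rho> / 2 \<le> norm (p - y)"
    using p(1) r by (simp add: dist_norm norm_minus_commute)
  then have "(\<rho> / 2)\<^sup>2 \<le> (norm (p - y))\<^sup>2" using \<rho> by (intro power_mono) auto
  then have n4: "\<rho>\<^sup>2 \<le> 4 * (norm (p - y))\<^sup>2" by (simp add: power_divide)
  have "K < 1 * (K + 1)" by simp
  also have "\<dots> \<le> \<alpha> * (\<alpha> * \<rho>\<^sup>2 - 2 * N)"
    using \<alpha>1 \<alpha>2 K by (intro mult_mono) auto
  also have "\<dots> \<le> \<alpha> * (\<alpha> * (4 * (norm (p - y))\<^sup>2) - 2 * N)"
    using \<alpha>1 n4 by (intro mult_left_mono diff_right_mono) auto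
  also have "\<dots> = 4 * \<alpha>\<^sup>2 * (norm (p - y))\<^sup>2 - 2 * \<alpha> * N"
    by (simp add: power2_eq_square algebra_simps)
  finally have "K * (m * E p) < (4 * \<alpha>\<^sup>2 * (norm (p - y))\<^sup>2 - 2 * \<alpha> * N) * (m * E p)"
    using m(1) E0 by (intro mult_strict_right_mono) auto
  then show False using Lp p(3) by (simp add: algebra_simps)
qed

text \<open>
  The local form of the strong maximum principle: near a zero, a point where \<open>z > 0\<close> has a largest
  ball free of zeros, and \<open>no_isolated_touching_point\<close> excludes the zero on its boundary.
\<close>
lemma open_zero_set:
  fixes z :: "'a::euclidean_space \<Rightarrow> real"
  assumes D: "open D" and z: "continuous_on D z" "\<And>x. x \<in> D \<Longrightarrow> 0 \<le> z x"
    and L: "\<And>x. x \<in> D \<Longrightarrow> has_laplacian z x (L x)"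
    and c: "continuous_on D c" and le: "\<And>x. x \<in> D \<Longrightarrow> L x \<le> c x * z x"
  shows "open {x \<in> D. z x = 0}"
proof (rule openI)
  fix x0 assume "x0 \<in> {x \<in> D. z x = 0}"
  then have x0: "x0 \<in> D" "z x0 = 0" by auto
  obtain e where e: "e > 0" "cball x0 e \<subseteq> D"
    using D x0(1) open_contains_cball by blast
  define R where "R = e / 3"
  have R: "R > 0" "cball x0 (3 * R) \<subseteq> D" using e by (auto simp: R_def)
  obtain K where K: "0 \<le> K" "\<And>x. x \<in> cball x0 (3 * R) \<Longrightarrow> c x \<le> K"
  proof -
    have "cball x0 (3 * R) \<noteq> {}" using R(1) by simp
    then obtain q where "\<And>x. x \<in> cball x0 (3 * R) \<Longrightarrow> c x \<le> c q"
      using continuous_attains_sup[OF compact_cball _ continuous_on_subset[OF c R(2)]] by blast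
    then show thesis by (intro that[of "max 0 (c q)"]) (auto simp: max.coboundedI2)
  qed
  have "z y = 0" if y: "y \<in> ball x0 R" for y
  proof (rule ccontr)
    assume zy: "z y \<noteq> 0"
    define Z where "Z = {x \<in> cball x0 (2 * R). z x = 0}"
    have cb2: "cball x0 (2 * R) \<subseteq> D" using R by auto
    have "closed Z"
      unfolding Z_def
      by (rule continuous_closed_preimage_constant[OF continuous_on_subset[OF z(1) cb2]]) simp
    moreover have "x0 \<in> Z" using x0 R(1) by (simp add: Z_def)
    ultimately obtain x1 where x1: "x1 \<in> Z" "\<And>x. x \<in> Z \<Longrightarrow> dist y x1 \<le> dist y x"
      using distance_attains_inf[of Z y] by auto
    define \<rho> where "\<rho> = dist y x1 / 2"
    define y' where "y' = (1/2) *\<^sub>R (y + x1)"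
    have zx1: "z x1 = 0" using x1(1) by (simp add: Z_def)
    have "y \<noteq> x1" using zx1 zy by auto
    then have \<rho>: "\<rho> > 0" by (simp add: \<rho>_def)
    have "dist y x1 \<le> dist y x0" using x1(2) \<open>x0 \<in> Z\<close> by blast
    then have yx1: "dist y x1 < R" using y by (simp add: dist_commute)
    have x1x0: "dist x0 x1 < 2 * R"
      using dist_triangle[of x0 x1 y] yx1 y by simp
    have d1: "dist y' x1 = \<rho>"
    proof -
      have "y' - x1 = (1/2) *\<^sub>R (y - x1)"
        by (simp add: y'_def algebra_simps scaleR_2[symmetric])
      then show ?thesis by (simp add: dist_norm \<rho>_def)
    qed
    \<comment> \<open>The halved ball meets the boundary of the original one only at the touching point.\<close>
    have inner: "dist y x < 2 * \<rho>" if x: "x \<in> cball y' \<rho>" "x \<noteq> x1" for x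
    proof -
      define a b where "a = x - y'" and "b = x1 - y'"
      have b: "norm b = \<rho>" using d1 by (simp add: b_def dist_norm norm_minus_commute)
      have a: "norm a \<le> \<rho>" using x(1) by (simp add: a_def dist_norm norm_minus_commute)
      have ab: "a + b = x - y"
        by (simp add: a_def b_def y'_def algebra_simps scaleR_2[symmetric])
      have "(norm (a + b))\<^sup>2 + (norm (a - b))\<^sup>2 = 2 * (norm a)\<^sup>2 + 2 * (norm b)\<^sup>2"
        by (simp add: power2_norm_eq_inner algebra_simps inner_commute)
      moreover have "0 < (norm (a - b))\<^sup>2" using x(2) by (simp add: a_def b_def)
      moreover have "(norm a)\<^sup>2 \<le> \<rho>\<^sup>2" using a by (intro power_mono) auto
      ultimately have "(norm (x - y))\<^sup>2 < 2 * \<rho>\<^sup>2 + 2 * (norm b)\<^sup>2"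
        unfolding ab by linarith
      then have "(norm (x - y))\<^sup>2 < 4 * \<rho>\<^sup>2" by (simp add: b)
      then have "(norm (x - y))\<^sup>2 < (2 * \<rho>)\<^sup>2" by (simp add: power_mult_distrib)
      then have "norm (x - y) < 2 * \<rho>"
        by (rule power2_less_imp_less) (use \<rho> in simp)
      then show ?thesis by (simp add: dist_norm norm_minus_commute)
    qed
    define r where "r = \<rho> / 2"
    have "2 * \<rho> < R" using yx1 by (simp add: \<rho>_def)
    then have rR: "r < R" using \<rho> by (simp add: r_def)
    have sub: "cball x1 r \<subseteq> cball x0 (3 * R)"
    proof
      fix x assume "x \<in> cball x1 r"
      then show "x \<in> cball x0 (3 * R)"
        using dist_triangle[of x0 x x1] x1x0 rR by simp
    qed
    have subD: "cball x1 r \<subseteq> D" using sub R(2) by blast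
    have "0 < z x1"
    proof (rule no_isolated_touching_point[where r = r and \<rho> = \<rho> and K = K and y = y' and L = L])
      show "continuous_on (cball x1 r) z" by (rule continuous_on_subset[OF z(1) subD])
      show "L x \<le> K * z x" if "x \<in> ball x1 r" for x
      proof -
        have x: "x \<in> cball x1 r" using that by auto
        have "L x \<le> c x * z x" using x subD by (intro le) auto
        also have "\<dots> \<le> K * z x"
          using x sub subD by (intro mult_right_mono K(2) z(2)) auto
        finally show ?thesis .
      qed
      show "0 < z x" if "x \<in> cball x1 r" "x \<in> cball y' \<rho>" "x \<noteq> x1" for x
      proof -
        have "dist y x < dist y x1" using inner[OF that(2,3)] by (simp add: \<rho>_def)
        then have "x \<notin> Z" using x1(2) by force
        moreover have "x \<in> cball x0 (2 * R)"
          using dist_triangle[of x0 x y] y yx1 \<open>dist y x < dist y x1\<close> by simp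
        ultimately have "z x \<noteq> 0" by (simp add: Z_def)
        then show ?thesis using z(2)[of x] that(1) subD by force
      qed
    qed (use subD z(2) L K(1) \<rho> d1 in \<open>auto simp: r_def subset_iff\<close>)
    then show False using zx1 by simp
  qed
  moreover have "ball x0 R \<subseteq> D" using R by auto
  ultimately show "\<exists>e>0. ball x0 e \<subseteq> {x \<in> D. z x = 0}"
    using R(1) by blast
qed

lemma strong_maximum_principle:
  fixes z :: "'a::euclidean_space \<Rightarrow> real"
  assumes D: "open D" and z: "continuous_on D z" "\<And>x. x \<in> D \<Longrightarrow> 0 \<le> z x"
    and L: "\<And>x. x \<in> D \<Longrightarrow> has_laplacian z x (L x)"
    and c: "continuous_on D c" and le: "\<And>x. x \<in> D \<Longrightarrow> L x \<le> c x * z x"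
    and A: "connected A" "A \<subseteq> D" and x0: "x0 \<in> A" "z x0 = 0" and x: "x \<in> A"
  shows "z x = 0"
proof (rule ccontr)
  assume nz: "z x \<noteq> 0"
  have "open {x \<in> D. z x = 0}" by (rule open_zero_set[OF D z L c le])
  moreover have "open (D \<inter> z -` (- {0}))"
    by (rule continuous_open_preimage[OF z(1) D]) (intro open_Compl closed_singleton)
  ultimately show False
    using connectedD[OF A(1), of "{x \<in> D. z x = 0}" "D \<inter> z -` (- {0})"] A(2) x0 x nz by auto
qed

text \<open>
  Here \<open>a\<close>, \<open>b\<close> stand for the values of \<open>u0\<close> at a point and at its reflection, and \<open>s\<close>, \<open>t\<close> for those of
  \<open>w\<close>. Monotonicity in the first argument replaces \<open>b\<close> by \<open>a\<close>, and the mean value theorem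
  handles the remaining difference.
\<close>
lemma reaction_difference_bound:
  fixes a b s t \<gamma> :: real
  assumes \<gamma>: "\<gamma> > 0" and a: "0 < a" "a \<le> b" and s: "0 < s" "s \<le> t"
  shows "((a + s) powr (- \<gamma>) - a powr (- \<gamma>)) - ((b + t) powr (- \<gamma>) - b powr (- \<gamma>))
      \<le> \<gamma> * (a + s) powr (- \<gamma> - 1) * (t - s)"
proof -
  let ?F = "\<lambda>x. x powr (- \<gamma>) - (x + t) powr (- \<gamma>)"
  have "?F b \<le> ?F a"
  proof (rule DERIV_nonpos_imp_nonincreasing[OF a(2)])
    fix x assume "a \<le> x" "x \<le> b"
    then have x: "0 < x" "0 < x + t" using a s by auto
    have "(?F has_real_derivative
        - \<gamma> * x powr (- \<gamma> - 1) - (- \<gamma> * (x + t) powr (- \<gamma> - 1))) (at x)"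
      using x by (auto intro!: derivative_eq_intros)
    moreover have "\<gamma> * (x + t) powr (- \<gamma> - 1) \<le> \<gamma> * x powr (- \<gamma> - 1)"
      using \<gamma> x s by (intro mult_left_mono powr_mono2') auto
    ultimately show "\<exists>y. (?F has_real_derivative y) (at x) \<and> y \<le> 0" by force
  qed
  moreover have "(a + s) powr (- \<gamma>) - (a + t) powr (- \<gamma>) \<le> \<gamma> * (a + s) powr (- \<gamma> - 1) * (t - s)"
  proof (cases "s = t")
    case False
    then have st: "a + s < a + t" using s by simp
    have "\<exists>\<xi>. \<xi> > a + s \<and> \<xi> < a + t \<and> (a + t) powr (- \<gamma>) - (a + s) powr (- \<gamma>)
        = (a + t - (a + s)) * (- \<gamma> * \<xi> powr (- \<gamma> - 1))"
      by (rule MVT2[OF st]) (use a s in \<open>auto intro!: derivative_eq_intros\<close>)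
    then obtain \<xi> where \<xi>: "\<xi> > a + s"
      "(a + s) powr (- \<gamma>) - (a + t) powr (- \<gamma>) = \<gamma> * \<xi> powr (- \<gamma> - 1) * (t - s)"
      by (auto simp: algebra_simps)
    have "\<xi> powr (- \<gamma> - 1) \<le> (a + s) powr (- \<gamma> - 1)"
      using \<xi>(1) a s \<gamma> by (intro powr_mono2') auto
    then show ?thesis
      unfolding \<xi>(2) using \<gamma> s by (intro mult_right_mono mult_left_mono) auto
  qed simp
  ultimately show ?thesis by simp
qed

section \<open>The position of the reflected cap\<close>

text \<open>
  For parameters below \<^const>\<open>lambda1\<close> the reflected cap lies in \<open>\<Omega>\<close> itself. The supremum need not be
  attained, so at the critical value only the closure is obtained, by passing to the limit.
\<close>
lemma reflection_cap_subset_closure: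
  assumes lam: "a_inf \<Omega> \<nu> < lam" "ereal lam \<le> lambda1 \<Omega> \<nu>"
  shows "reflection \<nu> lam ` cap \<Omega> \<nu> lam \<subseteq> closure \<Omega>"
proof safe
  fix x assume x: "x \<in> cap \<Omega> \<nu> lam"
  have mem: "reflection \<nu> t x \<in> \<Omega>" if t: "a_inf \<Omega> \<nu> < t" "x \<bullet> \<nu> < t" "t < lam" for t
  proof -
    have "ereal t < lambda1 \<Omega> \<nu>" using t(3) lam(2) by (metis ereal_less_eq(3) less_le_trans linorder_not_less)
    then obtain l where "t < l" "\<And>s. a_inf \<Omega> \<nu> < s \<Longrightarrow> s \<le> l \<Longrightarrow> reflection \<nu> s ` cap \<Omega> \<nu> s \<subseteq> \<Omega>"
      unfolding lambda1_def less_Sup_iff by auto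
    then show ?thesis using t x by (fastforce simp: cap_def)
  qed
  have "\<forall>\<^sub>F t in at_left lam. a_inf \<Omega> \<nu> < t" "\<forall>\<^sub>F t in at_left lam. x \<bullet> \<nu> < t"
    "\<forall>\<^sub>F t in at_left lam. t < lam"
    using lam(1) x by (auto simp: cap_def eventually_at_left_field)
  then have "\<forall>\<^sub>F t in at_left lam. reflection \<nu> t x \<in> closure \<Omega>"
    by eventually_elim (rule subsetD[OF closure_subset mem])
  moreover have "((\<lambda>t. reflection \<nu> t x) \<longlongrightarrow> reflection \<nu> lam x) (at_left lam)"
    unfolding reflection_def by (intro tendsto_intros)
  ultimately show "reflection \<nu> lam x \<in> closure \<Omega>"
    by (intro Lim_in_closed_set[OF closed_closure]) auto
qed

lemma reflection_closure_cap_subset_closure: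
  assumes "a_inf \<Omega> \<nu> < lam" "ereal lam \<le> lambda1 \<Omega> \<nu>" "x \<in> closure (cap \<Omega> \<nu> lam)"
  shows "reflection \<nu> lam x \<in> closure \<Omega>"
  using image_closure_subset[OF continuous_on_reflection closed_closure
      reflection_cap_subset_closure[OF assms(1,2)]] imageI[OF assms(3)] by (rule subsetD)

lemma open_cap:
  assumes "open \<Omega>"
  shows "open (cap \<Omega> \<nu> t)"
proof -
  have "cap \<Omega> \<nu> t = \<Omega> \<inter> {x. \<nu> \<bullet> x < t}" by (auto simp: cap_def inner_commute)
  then show ?thesis using assms by (simp add: open_Int open_halfspace_lt)
qed

lemma closure_cap_halfspace:
  assumes "x \<in> closure (cap \<Omega> \<nu> t)"
  shows "x \<bullet> \<nu> \<le> t"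
proof -
  have "cap \<Omega> \<nu> t \<subseteq> {x. \<nu> \<bullet> x \<le> t}" by (auto simp: cap_def inner_commute)
  from closure_minimal[OF this closed_halfspace_le] show ?thesis
    using assms by (auto simp: inner_commute)
qed

section \<open>Comparison of solutions\<close>

lemma positive_solution_diff_pos:
  fixes \<Omega> :: "'a::euclidean_space set"
  assumes \<Omega>: "open \<Omega>" "bounded \<Omega>" and \<gamma>: "\<gamma> > 0"
    and f_pos: "\<And>s. s > 0 \<Longrightarrow> f s > 0"
    and u0: "positive_solution \<Omega> (\<lambda>s. s powr (- \<gamma>)) u0"
    and u: "positive_solution \<Omega> (\<lambda>s. 1 / s powr \<gamma> + f s) u"
    and x: "x \<in> \<Omega>"
  shows "u0 x < u x"
proof (rule ccontr)
  assume neg: "\<not> u0 x < u x"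
  let ?v = "\<lambda>x. u x - u0 x"
  have lap: "has_laplacian ?v y (laplacian u y - laplacian u0 y)" if "y \<in> \<Omega>" for y
    using u u0 that \<Omega>(1)
    by (auto simp: positive_solution_def intro!: has_laplacian_diff intro: Ck_on_2_has_laplacian)
  have vc: "continuous_on (closure \<Omega>) ?v"
    using u u0 by (auto simp: positive_solution_def intro!: continuous_intros)
  have bd: "?v x \<le> ?v y" if "y \<in> frontier \<Omega>" for y
    using u u0 that neg by (auto simp: positive_solution_def)
  obtain p where p: "p \<in> \<Omega>" "?v p \<le> ?v x" "0 \<le> laplacian u p - laplacian u0 p"
    using interior_minimum[OF \<Omega> vc lap x bd] by blast
  have pos: "0 < u p" "0 < u0 p" and le: "u p \<le> u0 p"
    using u u0 p neg by (auto simp: positive_solution_def)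
  have "u0 p powr (- \<gamma>) \<le> u p powr (- \<gamma>)"
    using pos le \<gamma> by (intro powr_mono2') auto
  moreover have "laplacian u p = - (u p powr (- \<gamma>) + f (u p))" "laplacian u0 p = - (u0 p powr (- \<gamma>))"
    using u u0 p(1) by (auto simp: positive_solution_def powr_minus_divide)
  ultimately show False
    using p(3) f_pos[OF pos(1)] by simp
qed

text \<open>
  The moving plane comparison for the purely singular problem needs no continuation in the
  parameter, since the right-hand side is decreasing in the solution.
\<close>
lemma solution_le_reflection:
  fixes \<Omega> :: "'a::euclidean_space set"
  assumes \<Omega>: "open \<Omega>" "bounded \<Omega>" and \<gamma>: "\<gamma> > 0"
    and u0: "positive_solution \<Omega> (\<lambda>s. s powr (- \<gamma>)) u0"
    and \<nu>: "norm \<nu> = 1"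
    and lam: "a_inf \<Omega> \<nu> < lam" "ereal lam \<le> lambda1 \<Omega> \<nu>"
    and sub: "reflection \<nu> lam ` cap \<Omega> \<nu> lam \<subseteq> \<Omega>"
    and x: "x \<in> cap \<Omega> \<nu> lam"
  shows "u0 x \<le> u0 (reflection \<nu> lam x)"
proof (rule ccontr)
  let ?R = "reflection \<nu> lam" and ?D = "cap \<Omega> \<nu> lam"
  assume neg: "\<not> u0 x \<le> u0 (?R x)"
  let ?v = "\<lambda>x. u0 (?R x) - u0 x"
  have D: "open ?D" "bounded ?D" "?D \<subseteq> \<Omega>"
    using open_cap[OF \<Omega>(1)] bounded_subset[OF \<Omega>(2)] by (auto simp: cap_def)
  have cD: "closure ?D \<subseteq> closure \<Omega>" by (rule closure_mono[OF D(3)])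
  have RcD: "?R ` closure ?D \<subseteq> closure \<Omega>"
    using reflection_closure_cap_subset_closure[OF lam] by blast
  have u0c: "continuous_on (closure \<Omega>) u0" and u0C: "Ck_on 2 u0 \<Omega>"
    using u0 by (auto simp: positive_solution_def)
  have u0nn: "0 \<le> u0 y" if "y \<in> closure \<Omega>" for y
    using u0 that \<Omega>(1) by (cases "y \<in> \<Omega>") (auto simp: positive_solution_def frontier_def interior_open less_imp_le)
  have lap: "has_laplacian ?v y (laplacian u0 (?R y) - laplacian u0 y)" if "y \<in> ?D" for y
    using that sub D(3)
    by (intro has_laplacian_diff has_laplacian_compose_reflection[OF \<Omega>(1) u0C _ \<nu>]
        Ck_on_2_has_laplacian[OF \<Omega>(1) u0C]) auto
  have vc: "continuous_on (closure ?D) ?v"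
    by (intro continuous_on_diff continuous_on_compose2[OF u0c continuous_on_reflection RcD]
        continuous_on_subset[OF u0c cD])
  have bd: "?v x \<le> ?v y" if y: "y \<in> frontier ?D" for y
  proof -
    have yc: "y \<in> closure ?D" and "y \<notin> ?D"
      using y D(1) by (auto simp: frontier_def interior_open)
    have "y \<bullet> \<nu> \<le> lam" using closure_cap_halfspace[OF yc] .
    have "0 \<le> ?v y"
    proof (cases "y \<bullet> \<nu> = lam")
      case True
      then show ?thesis by (simp add: reflection_fixed)
    next
      case False
      then have "y \<notin> \<Omega>" using \<open>y \<notin> ?D\<close> \<open>y \<bullet> \<nu> \<le> lam\<close> by (simp add: cap_def)
      then have "y \<in> frontier \<Omega>" using yc cD \<Omega>(1) by (auto simp: frontier_def interior_open)
      then have "u0 y = 0" using u0 by (simp add: positive_solution_def)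
      then show ?thesis using u0nn RcD yc by auto
    qed
    then show ?thesis using neg by simp
  qed
  obtain p where p: "p \<in> ?D" "?v p \<le> ?v x" "0 \<le> laplacian u0 (?R p) - laplacian u0 p"
    using interior_minimum[OF D(1,2) vc lap x bd] by blast
  have mem: "p \<in> \<Omega>" "?R p \<in> \<Omega>" using p(1) D(3) sub by auto
  then have "0 < u0 (?R p)" using u0 by (simp add: positive_solution_def)
  then have "u0 p powr (- \<gamma>) < u0 (?R p) powr (- \<gamma>)"
    using p(2) neg \<gamma> by (intro powr_less_mono2_neg) auto
  moreover have "laplacian u0 p = - (u0 p powr (- \<gamma>))" "laplacian u0 (?R p) = - (u0 (?R p) powr (- \<gamma>))"
    using u0 mem by (auto simp: positive_solution_def)
  ultimately show False using p(3) by simp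
qed

section \<open>From a component of the cap to the whole cap\<close>

text \<open>
  Let \<open>Z\<close> be nonempty, open and relatively closed in the cap, a union of components of it. If no
  boundary point of \<open>\<Omega>\<close> in \<open>closure Z\<close> is reflected into \<open>\<Omega>\<close>, then \<open>Z\<close> and its mirror image, glued
  along the hyperplane, form an open and closed part of the connected set \<open>\<Omega>\<close>. So \<open>\<Omega>\<close> is symmetric
  and \<open>Z\<close> is the whole cap.
\<close>
lemma reflection_symmetric_domain:
  fixes \<Omega> :: "'a::euclidean_space set"
  assumes \<Omega>: "open \<Omega>" "connected \<Omega>" and \<nu>: "norm \<nu> = 1"
    and sub: "reflection \<nu> lam ` cap \<Omega> \<nu> lam \<subseteq> \<Omega>"
    and Z: "open Z" "Z \<subseteq> cap \<Omega> \<nu> lam" "Z \<noteq> {}" "closure Z \<inter> cap \<Omega> \<nu> lam \<subseteq> Z"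
    and bd: "\<And>x. x \<in> closure Z \<Longrightarrow> reflection \<nu> lam x \<in> \<Omega> \<Longrightarrow> x \<in> \<Omega>"
    and conn: "\<And>A. connected A \<Longrightarrow> A \<subseteq> cap \<Omega> \<nu> lam \<Longrightarrow> A \<inter> Z \<noteq> {} \<Longrightarrow> A \<subseteq> Z"
  shows "Z = cap \<Omega> \<nu> lam"
proof -
  let ?R = "reflection \<nu> lam" and ?D = "cap \<Omega> \<nu> lam"
  have RR: "?R (?R x) = x" for x by (rule reflection_reflection[OF \<nu>])
  have Rnu: "?R x \<bullet> \<nu> = 2 * lam - x \<bullet> \<nu>" for x by (rule inner_reflection[OF \<nu>])
  have RZ: "?R ` Z = ?R -` Z"
  proof safe
    fix x assume "?R x \<in> Z"
    then show "x \<in> ?R ` Z" using RR by (metis imageI)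
  qed (simp add: RR)
  have opR: "open (?R -` S)" if "open S" for S
    by (rule open_vimage[OF that continuous_on_reflection])
  have clR: "closure (?R ` Z) \<subseteq> ?R -` closure Z"
  proof (rule closure_minimal)
    show "?R ` Z \<subseteq> ?R -` closure Z" using closure_subset[of Z] by (auto simp: RR)
    show "closed (?R -` closure Z)"
      by (rule closed_vimage[OF closed_closure continuous_on_reflection])
  qed
  define C where "C = closure (Z \<union> ?R ` Z)"
  have C: "C = closure Z \<union> closure (?R ` Z)" by (simp add: C_def)
  have clZ: "x \<bullet> \<nu> \<le> lam" if "x \<in> closure Z" for x
    using closure_cap_halfspace closure_mono[OF Z(2)] that by blast
  have left: "x \<in> Z" if "x \<in> C" "x \<in> \<Omega>" "x \<bullet> \<nu> < lam" for x
  proof -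
    have "x \<notin> closure (?R ` Z)" using clR clZ[of "?R x"] Rnu[of x] that(3) by auto
    then show ?thesis using that Z(4) by (auto simp: C cap_def)
  qed
  have nbhd: "\<exists>T. open T \<and> x \<in> T \<and> T \<subseteq> C" if x: "x \<in> \<Omega> \<inter> C" for x
  proof -
    consider "x \<bullet> \<nu> < lam" | "x \<bullet> \<nu> > lam" | "x \<bullet> \<nu> = lam" by linarith
    then show ?thesis
    proof cases
      case 1
      then have "x \<in> Z" using left x by auto
      moreover have "Z \<subseteq> C" using closure_subset by (auto simp: C)
      ultimately show ?thesis using Z(1) by blast
    next
      case 2
      then have "x \<notin> closure Z" using clZ[of x] by auto
      then have Rx: "?R x \<in> closure Z" using x clR by (auto simp: C)
      then have "?R x \<in> \<Omega>" using bd[OF Rx] RR x by auto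
      then have "?R x \<in> Z" using Rx Z(4) 2 Rnu[of x] by (auto simp: cap_def)
      then have "x \<in> ?R -` Z" by simp
      moreover have "?R -` Z \<subseteq> C" using closure_subset[of "?R ` Z"] by (auto simp: C RZ)
      ultimately show ?thesis using opR[OF Z(1)] by blast
    next
      case 3
      then have "?R x = x" by (rule reflection_fixed)
      then have xZ: "x \<in> closure Z" using x clR by (auto simp: C)
      obtain r where r: "r > 0" "ball x r \<subseteq> \<Omega>" using \<Omega>(1) x open_contains_ball by blast
      define H where "H = ball x r \<inter> {y. y \<bullet> \<nu> < lam}"
      have "convex H"
        unfolding H_def using convex_halfspace_lt[of \<nu> lam] by (intro convex_Int convex_ball) (simp add: inner_commute)
      then have "connected H" by (rule convex_connected)
      moreover have "H \<subseteq> ?D" using r by (auto simp: H_def cap_def)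
      moreover have "H \<inter> Z \<noteq> {}"
      proof -
        obtain y where "y \<in> Z" "dist y x < r" using xZ r(1) by (auto simp: closure_approachable)
        then show ?thesis using Z(2) by (auto simp: H_def cap_def dist_commute)
      qed
      ultimately have HZ: "H \<subseteq> Z" by (rule conn)
      \<comment> \<open>Near a point of the hyperplane, the half ball \<open>H\<close>, its mirror image and the flat disc between them fill the ball.\<close>
      have "ball x r \<subseteq> C"
      proof
        fix y assume y: "y \<in> ball x r"
        have Ry: "?R y \<in> ball x r"
          using dist_reflection[OF \<nu>, of lam x y] \<open>?R x = x\<close> y by simp
        consider "y \<bullet> \<nu> < lam" | "y \<bullet> \<nu> > lam" | "y \<bullet> \<nu> = lam" by linarith
        then show "y \<in> C"
        proof cases
          case 1
          then have "y \<in> Z" using y HZ by (auto simp: H_def)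
          then show ?thesis using closure_subset by (auto simp: C)
        next
          case 2
          then have "?R y \<in> Z" using Ry HZ Rnu[of y] by (auto simp: H_def)
          then have "y \<in> ?R ` Z" by (simp add: RZ)
          then show ?thesis using closure_subset[of "?R ` Z"] by (auto simp: C)
        next
          case 3
          have nn: "\<nu> \<bullet> \<nu> = 1" using \<nu> by (simp add: dot_square_norm)
          have lim: "((\<lambda>t. y - t *\<^sub>R \<nu>) \<longlongrightarrow> y - 0 *\<^sub>R \<nu>) (at_right 0)"
            by (intro tendsto_intros)
          then have "\<forall>\<^sub>F t in at_right 0. y - t *\<^sub>R \<nu> \<in> ball x r"
            using y by (intro topological_tendstoD[OF lim]) auto
          moreover have "\<forall>\<^sub>F t in at_right (0::real). 0 < t"
            by (rule eventually_at_right_less)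
          ultimately have "\<forall>\<^sub>F t in at_right 0. y - t *\<^sub>R \<nu> \<in> closure Z"
          proof eventually_elim
            case (elim t)
            then have "y - t *\<^sub>R \<nu> \<in> H" using 3 by (simp add: H_def inner_diff_left nn)
            then show ?case using HZ closure_subset by blast
          qed
          then have "y - 0 *\<^sub>R \<nu> \<in> closure Z"
            by (intro Lim_in_closed_set[OF closed_closure _ _ lim]) auto
          then show ?thesis by (simp add: C)
        qed
      qed
      then show ?thesis using r(1) by (intro exI[of _ "ball x r"]) auto
    qed
  qed
  have "open (\<Omega> \<inter> C)"
  proof (subst open_subopen, intro ballI)
    fix x assume x: "x \<in> \<Omega> \<inter> C"
    then obtain T where "open T" "x \<in> T" "T \<subseteq> C" using nbhd by blast
    then show "\<exists>T. open T \<and> x \<in> T \<and> T \<subseteq> \<Omega> \<inter> C"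
      using \<Omega>(1) x by (intro exI[of _ "\<Omega> \<inter> T"]) auto
  qed
  moreover have "open (- C)" unfolding C_def by (rule open_Compl[OF closed_closure])
  moreover have "\<Omega> \<inter> C \<noteq> {}"
    using Z(2,3) closure_subset by (fastforce simp: C cap_def)
  ultimately have "\<Omega> \<subseteq> C"
    using connectedD[OF \<Omega>(2), of "\<Omega> \<inter> C" "- C"] by blast
  then have "?D \<subseteq> Z" using left by (auto simp: cap_def)
  with Z(2) show ?thesis by blast
qed

section \<open>The strong comparison principle\<close>

theorem lemma4p5:
  fixes \<Omega> :: "(real ^ 'n) set"
    and \<gamma> lam :: real
    and f :: "real \<Rightarrow> real"
    and u u0 w :: "real ^ 'n \<Rightarrow> real"
    and \<nu> :: "real ^ 'n"
  assumes gamma: "\<gamma> > 0"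
    and domain: "bounded_smooth_domain \<Omega>"
    and f_lip: "local_lipschitz (UNIV :: real set) {0..} (\<lambda>_. f)"
    and f_mono: "mono_on {0..} f"
    and f_pos: "\<And>s. s > 0 \<Longrightarrow> f s > 0"
    and f_zero: "f 0 \<ge> 0"
    and u0: "positive_solution \<Omega> (\<lambda>s. s powr (- \<gamma>)) u0"
    and u: "positive_solution \<Omega> (\<lambda>s. 1 / s powr \<gamma> + f s) u"
    and w: "\<And>x. x \<in> closure \<Omega> \<Longrightarrow> w x = u x - u0 x"
    and nu: "norm \<nu> = 1"
    and lambda: "a_inf \<Omega> \<nu> < lam" "ereal lam \<le> lambda1 \<Omega> \<nu>"
    and w_le: "\<And>x. x \<in> cap \<Omega> \<nu> lam \<Longrightarrow> w x \<le> w (reflection \<nu> lam x)"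
  shows "(\<forall>x\<in>cap \<Omega> \<nu> lam. w x < w (reflection \<nu> lam x)) \<or>
         (\<forall>x\<in>cap \<Omega> \<nu> lam. w x = w (reflection \<nu> lam x))"
proof -
  let ?R = "reflection \<nu> lam" and ?D = "cap \<Omega> \<nu> lam"
  have \<Omega>: "open \<Omega>" "connected \<Omega>" "bounded \<Omega>"
    using domain by (auto simp: bounded_smooth_domain_def)
  have D: "open ?D" "?D \<subseteq> \<Omega>" using open_cap[OF \<Omega>(1)] by (auto simp: cap_def)
  have cD: "closure ?D \<subseteq> closure \<Omega>" by (rule closure_mono[OF D(2)])
  have RcD: "?R ` closure ?D \<subseteq> closure \<Omega>"
    using reflection_closure_cap_subset_closure[OF lambda] by blast
  have \<Omega>c: "x \<in> closure \<Omega>" if "x \<in> \<Omega>" for x using that closure_subset by blast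
  have uc: "continuous_on (closure \<Omega>) u" and u0c: "continuous_on (closure \<Omega>) u0"
    and uC: "Ck_on 2 u \<Omega>" and u0C: "Ck_on 2 u0 \<Omega>"
    and upos: "\<And>x. x \<in> \<Omega> \<Longrightarrow> 0 < u x" and u0pos: "\<And>x. x \<in> \<Omega> \<Longrightarrow> 0 < u0 x"
    using u u0 by (auto simp: positive_solution_def)
  have lap_u: "laplacian u x = - (u x powr (- \<gamma>) + f (u x))"
    and lap_u0: "laplacian u0 x = - (u0 x powr (- \<gamma>))" if "x \<in> \<Omega>" for x
    using u u0 that by (auto simp: positive_solution_def powr_minus_divide)
  have w_pos: "0 < w x" if "x \<in> \<Omega>" for x
    using positive_solution_diff_pos[OF \<Omega>(1,3) gamma f_pos u0 u that] w[OF \<Omega>c[OF that]] by simp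
  have w_zero: "w x = 0" if "x \<in> closure \<Omega>" "x \<notin> \<Omega>" for x
  proof -
    have "x \<in> frontier \<Omega>" using that \<Omega>(1) by (simp add: frontier_def interior_open)
    then show ?thesis using w[OF that(1)] u u0 by (simp add: positive_solution_def)
  qed
  have sub: "?R ` ?D \<subseteq> \<Omega>"
  proof safe
    fix x assume x: "x \<in> ?D"
    then have "0 < w (?R x)" using w_pos w_le D(2) by (meson less_le_trans subsetD)
    moreover have "?R x \<in> closure \<Omega>" using reflection_cap_subset_closure[OF lambda] x by blast
    ultimately show "?R x \<in> \<Omega>" using w_zero by force
  qed
  define z where "z x = (u (?R x) - u0 (?R x)) - (u x - u0 x)" for x
  have zw: "z x = w (?R x) - w x" if "x \<in> closure ?D" for x
    using w that cD RcD unfolding z_def by (metis image_subset_iff subsetD)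
  have Dc: "x \<in> closure ?D" if "x \<in> ?D" for x using that closure_subset by blast
  have z_nonneg: "0 \<le> z x" if "x \<in> ?D" for x using zw[OF Dc[OF that]] w_le[OF that] by simp
  have zc: "continuous_on (closure ?D) z"
    unfolding z_def
    by (intro continuous_on_diff continuous_on_compose2[OF uc continuous_on_reflection RcD]
        continuous_on_compose2[OF u0c continuous_on_reflection RcD]
        continuous_on_subset[OF uc cD] continuous_on_subset[OF u0c cD])
  have zcD: "continuous_on ?D z" using zc closure_subset by (rule continuous_on_subset)
  define L where "L x = (laplacian u (?R x) - laplacian u0 (?R x)) - (laplacian u x - laplacian u0 x)" for x
  have lap_z: "has_laplacian z x (L x)" if "x \<in> ?D" for x
    unfolding z_def L_def using that sub D(2)
    by (intro has_laplacian_diff has_laplacian_compose_reflection[OF \<Omega>(1) _ _ nu] uC u0C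
        Ck_on_2_has_laplacian[OF \<Omega>(1)]) auto
  define c where "c x = \<gamma> * u x powr (- \<gamma> - 1)" for x
  have cc: "continuous_on ?D c"
    unfolding c_def using continuous_on_subset[OF uc] cD closure_subset[of ?D] upos D(2)
    by (intro continuous_intros) (auto dest!: upos[THEN less_imp_neq[THEN not_sym]] subsetD[OF D(2)])
  have L_le: "L x \<le> c x * z x" if x: "x \<in> ?D" for x
  proof -
    have mem: "x \<in> \<Omega>" "?R x \<in> \<Omega>" using x D(2) sub by auto
    have u0_le: "u0 x \<le> u0 (?R x)"
      by (rule solution_le_reflection[OF \<Omega>(1,3) gamma u0 nu lambda sub x])
    have s: "0 < u x - u0 x" "u x - u0 x \<le> u (?R x) - u0 (?R x)"
      using w_pos[OF mem(1)] w[OF \<Omega>c[OF mem(1)]] z_nonneg[OF x] by (auto simp: z_def)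
    have "f (u x) \<le> f (u (?R x))"
      using u0_le s(2) upos[OF mem(1)] by (intro mono_onD[OF f_mono]) auto
    moreover have "(u x powr (- \<gamma>) - u0 x powr (- \<gamma>)) - (u (?R x) powr (- \<gamma>) - u0 (?R x) powr (- \<gamma>))
        \<le> c x * z x"
      using reaction_difference_bound[OF gamma u0pos[OF mem(1)] u0_le s] by (simp add: c_def z_def)
    ultimately show ?thesis
      using mem by (simp add: L_def lap_u lap_u0)
  qed
  define Z where "Z = {x \<in> ?D. z x = 0}"
  have "Z = ?D" if "Z \<noteq> {}"
  proof (rule reflection_symmetric_domain[OF \<Omega>(1,2) nu sub _ _ that])
    show "open Z" unfolding Z_def by (rule open_zero_set[OF D(1) zcD z_nonneg lap_z cc L_le])
    show ZD: "Z \<subseteq> ?D" by (auto simp: Z_def)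
    have z0: "z x = 0" if "x \<in> closure Z" for x
      using continuous_constant_on_closure[OF continuous_on_subset[OF zc closure_mono[OF ZD]] _ that]
      by (auto simp: Z_def)
    show "closure Z \<inter> ?D \<subseteq> Z" using z0 by (subst (2) Z_def) blast
    show "x \<in> \<Omega>" if x: "x \<in> closure Z" and Rx: "?R x \<in> \<Omega>" for x
    proof -
      have xc: "x \<in> closure ?D" using x closure_mono[OF ZD] by blast
      then have "w x = w (?R x)" using zw z0[OF x] by simp
      then have "w x \<noteq> 0" using w_pos[OF Rx] by simp
      then show ?thesis using w_zero xc cD by blast
    qed
    show "A \<subseteq> Z" if A: "connected A" "A \<subseteq> ?D" "A \<inter> Z \<noteq> {}" for A
    proof -
      obtain x0 where "x0 \<in> A" "z x0 = 0" using A(3) by (auto simp: Z_def)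
      then show ?thesis
        using strong_maximum_principle[OF D(1) zcD z_nonneg lap_z cc L_le A(1,2)] A(2)
        unfolding Z_def by blast
    qed
  qed
  moreover have "x \<in> Z \<longleftrightarrow> w x = w (?R x)" if "x \<in> ?D" for x
    using zw[OF Dc[OF that]] that by (auto simp: Z_def)
  moreover have "w x < w (?R x) \<or> w x = w (?R x)" if "x \<in> ?D" for x
    using w_le[OF that] by linarith
  ultimately show ?thesis by blast
qed

end
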